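(* The tree $\mathcal{D}_1$ (coding symmetric bimodal maps between $(M^{\infty},M^{\infty})$ and $(RM^{\infty},LM^{\infty})$) is isomorphic, as an ordered tree, to the tree $\mathcal{T}_{KS}$ of kneading sequences of unimodal maps.
   Context: **Symmetric bimodal maps.** A symmetric bimodal map is a continuous map $f$ of an interval $I=[c_0,c_3]$, symmetric about $0$, into itself, with $f(-x)=-f(x)$, having two turning points $c_1<c_2=-c_1$ in the interior of $I$, strictly increasing on $[c_0,c_1]$ and $[c_2,c_3]$ and strictly decreasing on $[c_1,c_2]$. The itinerary of $f(c_1)$ is the sequence $S_1S_2\dots$ over $\{L,A,M,B,R\}$ where $S_j=L,A,M,B,R$ according to whether $f^j(c_1)<c_1$, $=c_1$, in $(c_1,c_2)$, $=c_2$, $>c_2$ respectively. The itinerary of $f(c_2)$ is defined likewise from $f^j(c_2)$. **Conjugation.** For a word $P^{(p-1)}=P_1\cdots P_{p-1}$ over $\{L,M,R\}$ put $\overline{P^{(p-1)}}=\overline{P_1}\cdots\overline{P_{p-1}}$, where $\overline L=R$, $\overline M=M$, $\overline R=L$. **The set $\mathcal{D}$.** $\mathcal{D}$ is the set of kneading data $S$ realized by symmetric bimodal maps with periodic turning points. Each $S$ is given by an integer $p\ge 1$ and a word $P^{(p-1)}$ over $\{L,M,R\}$, and is one of two types: a *pair of stable orbits* $S=(P^{(p-1)}A,\overline{P^{(p-1)}}B)$, meaning that the itinerary of $f(c_1)$ is the periodic sequence $(P^{(p-1)}A)^{\infty}$ and that of $f(c_2)$ is $(\overline{P^{(p-1)}}B)^{\infty}$;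 or a *doubly stable orbit* $S=P^{(p-1)}B\,\overline{P^{(p-1)}}A$, meaning that the itinerary of $f(c_1)$ is $(P^{(p-1)}B\,\overline{P^{(p-1)}}A)^{\infty}$. "Realized" means that some symmetric bimodal map $f$ has these itineraries. **Order.** Sequences over $\{L,A,M,B,R\}$ are compared by the signed lexicographic order: at the first position where two sequences differ, compare the symbols by $L<A<M<B<R$ if the common prefix contains an even number of symbols $M$, and by the reverse order if it contains an odd number. $\mathcal{D}$ is ordered by the order of the itineraries of $f(c_1)$. **$\mathcal{D}_1$.** $\mathcal{D}_1\subset\mathcal{D}$ is the set of those $S\in\mathcal{D}$ lying between $(M^{\infty},M^{\infty})$ and $(RM^{\infty},LM^{\infty})$, i.e. whose itinerary of $f(c_1)$ lies between $M^{\infty}$ and $RM^{\infty}$. The element $S$ determined by $P^{(p-1)}$ has level $p$; the tree structure is given by the relation "$P^{(p-1)}$ is a prefix of $Q^{(q-1)}$". **$\mathcal{T}_{KS}$.** This is the set of words $P^{(p-1)}C$, $p\ge1$, with $P^{(p-1)}$ a word over $\{L,R\}$, such that the periodic sequence $(P^{(p-1)}C)^{\infty}$ is the itinerary of $g(c)$ for some unimodal map $g$ (continuous interval self-map, strictly increasing to the left of its turning point $c$, strictly decreasing to the right; symbols $L,C,R$ for left of, equal to, right of $c$). Equivalently $\sigma^i(P^{(p-1)}C)\le P^{(p-1)}C$ for all $i$, where $\sigma$ is the shift on the periodic sequence and $\le$ is the signed lexicographic order based on $L<C<R$, reversed when the common prefix contains an odd number of symbols $R$. $\mathcal{T}_{KS}$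 carries this order; the level of $P^{(p-1)}C$ is $p$, and the tree structure is given by the prefix relation on the words $P^{(p-1)}$. **Isomorphism.** Isomorphic as ordered trees means that there is a bijection preserving levels, the prefix relation, and the order. *)

theory Defs
  imports Complex_Main "HOL-Library.Sublist"
begin

datatype bimodal_symbol = L\<^sub>b | A\<^sub>b | M\<^sub>b | B\<^sub>b | R\<^sub>b

datatype unimodal_symbol = L\<^sub>u | C\<^sub>u | R\<^sub>u

primrec bimodal_rank :: "bimodal_symbol \<Rightarrow> nat" where
  "bimodal_rank L\<^sub>b = 0"
| "bimodal_rank A\<^sub>b = 1"
| "bimodal_rank M\<^sub>b = 2"
| "bimodal_rank B\<^sub>b = 3"
| "bimodal_rank R\<^sub>b = 4"

primrec unimodal_rank :: "unimodal_symbol \<Rightarrow> nat" where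
  "unimodal_rank L\<^sub>u = 0"
| "unimodal_rank C\<^sub>u = 1"
| "unimodal_rank R\<^sub>u = 2"

instantiation bimodal_symbol :: linorder
begin

definition less_eq_bimodal_symbol :: "bimodal_symbol \<Rightarrow> bimodal_symbol \<Rightarrow> bool" where
  "x \<le> y \<longleftrightarrow> bimodal_rank x \<le> bimodal_rank y"

definition less_bimodal_symbol :: "bimodal_symbol \<Rightarrow> bimodal_symbol \<Rightarrow> bool" where
  "x < y \<longleftrightarrow> bimodal_rank x < bimodal_rank y"

instance
proof
  fix x y :: bimodal_symbol
  assume "x \<le> y" "y \<le> x"
  then show "x = y"
    by (cases x; cases y) (simp_all add: less_eq_bimodal_symbol_def)
qed (auto simp: less_eq_bimodal_symbol_def less_bimodal_symbol_def)

end

instantiation unimodal_symbol :: linorder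
begin

definition less_eq_unimodal_symbol :: "unimodal_symbol \<Rightarrow> unimodal_symbol \<Rightarrow> bool" where
  "x \<le> y \<longleftrightarrow> unimodal_rank x \<le> unimodal_rank y"

definition less_unimodal_symbol :: "unimodal_symbol \<Rightarrow> unimodal_symbol \<Rightarrow> bool" where
  "x < y \<longleftrightarrow> unimodal_rank x < unimodal_rank y"

instance
proof
  fix x y :: unimodal_symbol
  assume "x \<le> y" "y \<le> x"
  then show "x = y"
    by (cases x; cases y) (simp_all add: less_eq_unimodal_symbol_def)
qed (auto simp: less_eq_unimodal_symbol_def less_unimodal_symbol_def)

end

definition periodic_sequence :: "'a list \<Rightarrow> nat \<Rightarrow> 'a" where
  "periodic_sequence w n = w ! (n mod length w)"

text \<open>The parameter \<open>r\<close> is the order-reversing symbol: \<open>M\<close> for bimodal, \<open>R\<close> for unimodal maps.\<close>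

definition signed_lex_less :: "'a::linorder \<Rightarrow> (nat \<Rightarrow> 'a) \<Rightarrow> (nat \<Rightarrow> 'a) \<Rightarrow> bool" where
  "signed_lex_less r s t \<longleftrightarrow>
     (\<exists>n. (\<forall>k<n. s k = t k) \<and>
          (if even (card {k. k < n \<and> s k = r}) then s n < t n else t n < s n))"

definition symmetric_bimodal ::
    "(real \<Rightarrow> real) \<Rightarrow> real \<Rightarrow> real \<Rightarrow> real \<Rightarrow> real \<Rightarrow> bool" where
  "symmetric_bimodal f c0 c1 c2 c3 \<longleftrightarrow>
     c0 < c1 \<and> c1 < c2 \<and> c2 < c3 \<and> c0 = - c3 \<and> c2 = - c1 \<and>
     continuous_on {c0..c3} f \<and> f ` {c0..c3} \<subseteq> {c0..c3} \<and>
     (\<forall>x\<in>{c0..c3}. f (- x) = - f x) \<and>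
     strict_mono_on {c0..c1} f \<and> strict_antimono_on {c1..c2} f \<and> strict_mono_on {c2..c3} f"

definition bimodal_symbol_of :: "real \<Rightarrow> real \<Rightarrow> real \<Rightarrow> bimodal_symbol" where
  "bimodal_symbol_of c1 c2 x =
     (if x < c1 then L\<^sub>b else if x = c1 then A\<^sub>b
      else if x < c2 then M\<^sub>b else if x = c2 then B\<^sub>b else R\<^sub>b)"

definition bimodal_itinerary ::
    "(real \<Rightarrow> real) \<Rightarrow> real \<Rightarrow> real \<Rightarrow> real \<Rightarrow> nat \<Rightarrow> bimodal_symbol" where
  "bimodal_itinerary f c1 c2 x n = bimodal_symbol_of c1 c2 ((f ^^ n) x)"

text \<open>Only the values on \<open>L\<close>, \<open>M\<close>, \<open>R\<close> matter below.\<close>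

primrec conj_symbol :: "bimodal_symbol \<Rightarrow> bimodal_symbol" where
  "conj_symbol L\<^sub>b = R\<^sub>b"
| "conj_symbol A\<^sub>b = B\<^sub>b"
| "conj_symbol M\<^sub>b = M\<^sub>b"
| "conj_symbol B\<^sub>b = A\<^sub>b"
| "conj_symbol R\<^sub>b = L\<^sub>b"

abbreviation conj_word :: "bimodal_symbol list \<Rightarrow> bimodal_symbol list" where
  "conj_word \<equiv> map conj_symbol"

text \<open>With \<open>P'\<close> the conjugate of \<open>P\<close>, \<open>Stable_Pair P\<close> stands for \<open>(P A, P' B)\<close> and
  \<open>Doubly_Stable P\<close> for \<open>P B P' A\<close>.\<close>

datatype kneading_data =
    Stable_Pair (base_word: "bimodal_symbol list")
  | Doubly_Stable (base_word: "bimodal_symbol list")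

primrec itinerary_c1 :: "kneading_data \<Rightarrow> nat \<Rightarrow> bimodal_symbol" where
  "itinerary_c1 (Stable_Pair P) = periodic_sequence (P @ [A\<^sub>b])"
| "itinerary_c1 (Doubly_Stable P) = periodic_sequence (P @ [B\<^sub>b] @ conj_word P @ [A\<^sub>b])"

text \<open>For a doubly stable orbit the itinerary of \<open>f c2\<close> is not prescribed, since \<open>c2\<close> lies on
  the orbit of \<open>c1\<close>.\<close>

primrec realizes ::
    "(real \<Rightarrow> real) \<Rightarrow> real \<Rightarrow> real \<Rightarrow> kneading_data \<Rightarrow> bool" where
  "realizes f c1 c2 (Stable_Pair P) \<longleftrightarrow>
     bimodal_itinerary f c1 c2 (f c1) = periodic_sequence (P @ [A\<^sub>b]) \<and>
     bimodal_itinerary f c1 c2 (f c2) = periodic_sequence (conj_word P @ [B\<^sub>b])"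
| "realizes f c1 c2 (Doubly_Stable P) \<longleftrightarrow>
     bimodal_itinerary f c1 c2 (f c1) = periodic_sequence (P @ [B\<^sub>b] @ conj_word P @ [A\<^sub>b])"

definition \<D> :: "kneading_data set" where
  "\<D> = {S. set (base_word S) \<subseteq> {L\<^sub>b, M\<^sub>b, R\<^sub>b} \<and>
           (\<exists>f c0 c1 c2 c3. symmetric_bimodal f c0 c1 c2 c3 \<and> realizes f c1 c2 S)}"

text \<open>Itineraries of elements of \<open>\<D>\<close> contain \<open>A\<close> or \<open>B\<close>, so they never equal one of the two
  bounds, and strict and weak inequalities define the same set.\<close>

definition \<D>\<^sub>1 :: "kneading_data set" where
  "\<D>\<^sub>1 = {S \<in> \<D>. signed_lex_less M\<^sub>b (\<lambda>_. M\<^sub>b) (itinerary_c1 S) \<and>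
                signed_lex_less M\<^sub>b (itinerary_c1 S) (\<lambda>n. if n = 0 then R\<^sub>b else M\<^sub>b)}"

definition unimodal :: "(real \<Rightarrow> real) \<Rightarrow> real \<Rightarrow> real \<Rightarrow> real \<Rightarrow> bool" where
  "unimodal g a c b \<longleftrightarrow>
     a < c \<and> c < b \<and> continuous_on {a..b} g \<and> g ` {a..b} \<subseteq> {a..b} \<and>
     strict_mono_on {a..c} g \<and> strict_antimono_on {c..b} g"

definition unimodal_symbol_of :: "real \<Rightarrow> real \<Rightarrow> unimodal_symbol" where
  "unimodal_symbol_of c x = (if x < c then L\<^sub>u else if x = c then C\<^sub>u else R\<^sub>u)"

definition unimodal_itinerary :: "(real \<Rightarrow> real) \<Rightarrow> real \<Rightarrow> real \<Rightarrow> nat \<Rightarrow> unimodal_symbol" where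
  "unimodal_itinerary g c x n = unimodal_symbol_of c ((g ^^ n) x)"

definition \<T>_KS :: "unimodal_symbol list set" where
  "\<T>_KS = {P @ [C\<^sub>u] | P. set P \<subseteq> {L\<^sub>u, R\<^sub>u} \<and>
             (\<exists>g a c b. unimodal g a c b \<and>
                unimodal_itinerary g c (g c) = periodic_sequence (P @ [C\<^sub>u]))}"

record 'a ordered_tree =
  nodes :: "'a set"
  level :: "'a \<Rightarrow> nat"
  is_prefix :: "'a \<Rightarrow> 'a \<Rightarrow> bool"
  precedes :: "'a \<Rightarrow> 'a \<Rightarrow> bool"

definition isomorphic_ordered_trees :: "'a ordered_tree \<Rightarrow> 'b ordered_tree \<Rightarrow> bool" where
  "isomorphic_ordered_trees T U \<longleftrightarrow>
     (\<exists>\<phi>. bij_betw \<phi> (nodes T) (nodes U) \<and>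
        (\<forall>x\<in>nodes T. level U (\<phi> x) = level T x) \<and>
        (\<forall>x\<in>nodes T. \<forall>y\<in>nodes T. is_prefix U (\<phi> x) (\<phi> y) \<longleftrightarrow> is_prefix T x y) \<and>
        (\<forall>x\<in>nodes T. \<forall>y\<in>nodes T. precedes U (\<phi> x) (\<phi> y) \<longleftrightarrow> precedes T x y))"

definition \<D>\<^sub>1_tree :: "kneading_data ordered_tree" where
  "\<D>\<^sub>1_tree = \<lparr>
     nodes = \<D>\<^sub>1,
     level = (\<lambda>S. Suc (length (base_word S))),
     is_prefix = (\<lambda>S S'. prefix (base_word S) (base_word S')),
     precedes = (\<lambda>S S'. signed_lex_less M\<^sub>b (itinerary_c1 S) (itinerary_c1 S'))\<rparr>"

text \<open>A node \<open>P C\<close> is stored as the whole word, so \<open>butlast\<close> recovers \<open>P\<close>.\<close>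

definition \<T>_KS_tree :: "unimodal_symbol list ordered_tree" where
  "\<T>_KS_tree = \<lparr>
     nodes = \<T>_KS,
     level = length,
     is_prefix = (\<lambda>v w. prefix (butlast v) (butlast w)),
     precedes = (\<lambda>v w. signed_lex_less R\<^sub>u (periodic_sequence v) (periodic_sequence w))\<rparr>"

end

theory Submission
  imports Defs
begin

text \<open>
  A symmetric bimodal map \<open>f\<close> is odd, so it descends to the half-line \<open>x \<ge> 0\<close>: there
  \<open>g = - f\<close> starts at \<open>g 0 = 0\<close>, increases up to \<open>c2\<close> and decreases afterwards. As long as \<open>g\<close> is
  positive on \<open>{0<..v}\<close>, where \<open>v = f c1 = g c2\<close> is the largest value, \<open>g\<close> is a unimodal map of an
  interval with left end point \<open>0\<close>, and \<open>f\<^sup>n v = (-1)\<^sup>n g\<^sup>n v\<close> with \<open>g\<^sup>n v > 0\<close>. The upper bound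
  \<open>R M\<^sup>\<infinity>\<close> on the itinerary of \<open>v\<close> forces \<open>f v < 0\<close> when \<open>v > c2\<close>, which gives this positivity
  (\<open>folded_unimodal_map\<close>).

  Since the sign of \<open>f\<^sup>n v\<close> is known, the bimodal itinerary carries the same information as the
  unimodal one: \<open>M\<close> corresponds to \<open>L\<close>, and at time \<open>n\<close> the letters \<open>C\<close>, \<open>R\<close> correspond to \<open>B\<close>, \<open>R\<close>
  if \<open>n\<close> is even and to \<open>A\<close>, \<open>L\<close> if \<open>n\<close> is odd (\<open>lift_symbol\<close>). In particular a unimodal word \<open>P C\<close>
  of length \<open>p\<close> becomes a pair of stable orbits for even \<open>p\<close>, where the turning point is met at an odd
  time, and a doubly stable orbit for odd \<open>p\<close> (\<open>lift_data\<close>).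
  Conversely, any unimodal map can be extended to the left so that it fixes its left end point
  (\<open>unimodal_fixing_left_endpoint\<close>), and then its odd extension realizes the lifted data.

  The lift respects the signed orders. The comparison of two letters at time \<open>n\<close> is reversed once
  for each earlier \<open>M\<close>, that is, for each earlier \<open>L\<close> of the unimodal sequence, and once more if \<open>n\<close>
  is odd, because then the letters \<open>M > A > L\<close> stand for \<open>L < C < R\<close>. Modulo \<open>2\<close> these are as many
  reversals as there are earlier letters \<open>R\<close>, provided that no \<open>C\<close> occurs before time \<open>n\<close>
  (\<open>signed_lex_less_lift_iff\<close>).
\<close>

section \<open>Lifting unimodal sequences\<close>

text \<open>At time \<open>n\<close> the point \<open>(-1)\<^sup>n y\<close> stands for \<open>y > 0\<close>.\<close>

primrec lift_symbol :: "nat \<Rightarrow> unimodal_symbol \<Rightarrow> bimodal_symbol" where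
  "lift_symbol n L\<^sub>u = M\<^sub>b"
| "lift_symbol n C\<^sub>u = (if even n then B\<^sub>b else A\<^sub>b)"
| "lift_symbol n R\<^sub>u = (if even n then R\<^sub>b else L\<^sub>b)"

primrec fold_symbol :: "bimodal_symbol \<Rightarrow> unimodal_symbol" where
  "fold_symbol L\<^sub>b = R\<^sub>u"
| "fold_symbol A\<^sub>b = C\<^sub>u"
| "fold_symbol M\<^sub>b = L\<^sub>u"
| "fold_symbol B\<^sub>b = C\<^sub>u"
| "fold_symbol R\<^sub>b = R\<^sub>u"

definition lift_sequence :: "(nat \<Rightarrow> unimodal_symbol) \<Rightarrow> nat \<Rightarrow> bimodal_symbol" where
  "lift_sequence s n = lift_symbol n (s n)"

definition lift_word :: "unimodal_symbol list \<Rightarrow> bimodal_symbol list" where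
  "lift_word P = map (\<lambda>i. lift_symbol i (P ! i)) [0..<length P]"

definition lift_data :: "unimodal_symbol list \<Rightarrow> kneading_data" where
  "lift_data P = (if odd (length P) then Stable_Pair (lift_word P) else Doubly_Stable (lift_word P))"

lemma fold_lift_symbol [simp]: "fold_symbol (lift_symbol n x) = x"
  by (cases x) auto

lemma lift_symbol_eq_iff [simp]: "lift_symbol n x = lift_symbol n y \<longleftrightarrow> x = y"
  by (metis fold_lift_symbol)

lemma fold_conj_symbol [simp]: "fold_symbol (conj_symbol x) = fold_symbol x"
  by (cases x) auto

lemma lift_symbol_cong_parity: "even m = even n \<Longrightarrow> lift_symbol m x = lift_symbol n x"
  by (cases x) auto

lemma conj_lift_symbol: "even m \<noteq> even n \<Longrightarrow> conj_symbol (lift_symbol m x) = lift_symbol n x"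
  by (cases x) auto

lemma length_lift_word [simp]: "length (lift_word P) = length P"
  by (simp add: lift_word_def)

lemma map_fold_lift_word [simp]: "map fold_symbol (lift_word P) = P"
  by (rule nth_equalityI) (auto simp: lift_word_def)

lemma lift_word_append_prefix: "prefix (lift_word P) (lift_word (P @ Q))"
proof -
  have "take (length P) (lift_word (P @ Q)) = lift_word P"
    by (rule nth_equalityI) (auto simp: lift_word_def nth_append)
  then show ?thesis
    by (metis take_is_prefix)
qed

lemma prefix_lift_word_iff: "prefix (lift_word P) (lift_word Q) \<longleftrightarrow> prefix P Q"
proof
  assume "prefix (lift_word P) (lift_word Q)"
  then have "prefix (map fold_symbol (lift_word P)) (map fold_symbol (lift_word Q))"
    by (rule map_mono_prefix)
  then show "prefix P Q"
    by simp
qed (auto simp: prefix_def[of P Q] lift_word_append_prefix)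

lemma base_word_lift_data [simp]: "base_word (lift_data P) = lift_word P"
  by (simp add: lift_data_def)

lemma set_lift_word:
  assumes "set P \<subseteq> {L\<^sub>u, R\<^sub>u}"
  shows "set (lift_word P) \<subseteq> {L\<^sub>b, M\<^sub>b, R\<^sub>b}"
proof -
  have "lift_symbol i (P ! i) \<in> {L\<^sub>b, M\<^sub>b, R\<^sub>b}" if "i < length P" for i
  proof -
    have "P ! i \<in> {L\<^sub>u, R\<^sub>u}"
      using assms that nth_mem by blast
    then show ?thesis
      by (cases "P ! i") auto
  qed
  then show ?thesis
    unfolding lift_word_def by (simp only: set_map image_subset_iff set_upt atLeastLessThan_iff) simp
qed

section \<open>Periodic sequences\<close>

lemma periodic_sequence_map:
  assumes "w \<noteq> []"
  shows "periodic_sequence (map h w) = h \<circ> periodic_sequence w"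
  using assms by (auto simp: periodic_sequence_def fun_eq_iff)

lemma periodic_sequence_of_periodic:
  assumes "\<And>n. u (n + N) = u n" and "N > 0"
  shows "periodic_sequence (map u [0..<N]) = u"
proof
  fix n
  have shift: "u (m + k * N) = u m" for m k
  proof (induction k)
    case (Suc k)
    have "u (m + Suc k * N) = u (m + k * N + N)"
      by (simp add: algebra_simps)
    then show ?case
      using Suc assms(1) by simp
  qed simp
  have "u n = u (n mod N)"
    using shift[of "n mod N" "n div N"] by simp
  then show "periodic_sequence (map u [0..<N]) n = u n"
    using \<open>N > 0\<close> by (simp add: periodic_sequence_def)
qed

lemma periodic_sequence_period: "periodic_sequence w (n + length w) = periodic_sequence w n"
  by (simp add: periodic_sequence_def)

lemma periodic_sequence_double: "periodic_sequence (w @ w) = periodic_sequence w"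
proof (cases "w = []")
  case False
  have nth: "(w @ w) ! i = w ! (i mod length w)" if "i < length w + length w" for i
    using that by (cases "i < length w") (auto simp: nth_append not_less le_mod_geq)
  have "n mod (length w + length w) mod length w = n mod length w" for n
    by (simp add: mod_mod_cancel flip: mult_2)
  then show ?thesis
    using False nth by (simp add: periodic_sequence_def fun_eq_iff)
qed simp

lemma fold_itinerary_c1:
  "fold_symbol \<circ> itinerary_c1 S = periodic_sequence (map fold_symbol (base_word S) @ [C\<^sub>u])"
proof (cases S)
  case (Stable_Pair P)
  then show ?thesis
    using periodic_sequence_map[of "P @ [A\<^sub>b]" fold_symbol] by simp
next
  case (Doubly_Stable P)
  let ?w = "map fold_symbol P @ [C\<^sub>u]"
  have "fold_symbol \<circ> conj_symbol = fold_symbol"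
    by (simp add: fun_eq_iff)
  then have "map fold_symbol (P @ [B\<^sub>b] @ conj_word P @ [A\<^sub>b]) = ?w @ ?w"
    by simp
  moreover have "fold_symbol \<circ> itinerary_c1 S =
      periodic_sequence (map fold_symbol (P @ [B\<^sub>b] @ conj_word P @ [A\<^sub>b]))"
    using Doubly_Stable by (subst periodic_sequence_map) simp_all
  ultimately have "fold_symbol \<circ> itinerary_c1 S = periodic_sequence ?w"
    by (simp only: periodic_sequence_double)
  then show ?thesis
    using Doubly_Stable by simp
qed

text \<open>For a doubly stable orbit \<open>P B P' A\<close> of period \<open>2p\<close> with \<open>p\<close> odd, the second half repeats the
  unimodal word at times of the opposite parity, and this is conjugation.\<close>

lemma itinerary_c1_lift_data:
  "itinerary_c1 (lift_data P) = lift_sequence (periodic_sequence (P @ [C\<^sub>u]))"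
proof -
  let ?p = "Suc (length P)"
  let ?s = "periodic_sequence (P @ [C\<^sub>u])"
  let ?u = "lift_sequence ?s"
  have s_period: "?s (n + ?p) = ?s n" for n
    using periodic_sequence_period[of "P @ [C\<^sub>u]" n] by simp
  have u_head: "map ?u [0..<length P] = lift_word P"
    by (auto simp: lift_word_def lift_sequence_def periodic_sequence_def nth_append)
  have u_turn: "?u (length P) = (if even (length P) then B\<^sub>b else A\<^sub>b)"
    by (simp add: lift_sequence_def periodic_sequence_def)
  show ?thesis
  proof (cases "odd (length P)")
    case True
    have "?u (n + ?p) = ?u n" for n
      unfolding lift_sequence_def s_period using True by (intro lift_symbol_cong_parity) simp
    then have "periodic_sequence (map ?u [0..<?p]) = ?u"
      by (rule periodic_sequence_of_periodic) simp
    then show ?thesis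
      using True u_head u_turn by (simp add: lift_data_def)
  next
    case False
    have conj: "?u (n + ?p) = conj_symbol (?u n)" for n
      unfolding lift_sequence_def s_period
      by (rule conj_lift_symbol[symmetric]) (use False in simp)
    have "?u (n + (?p + ?p)) = ?u n" for n
    proof -
      have "?s (n + (?p + ?p)) = ?s n"
        using s_period[of "n + ?p"] s_period[of n] by (simp add: add.assoc)
      then show ?thesis
        unfolding lift_sequence_def by (auto intro: lift_symbol_cong_parity)
    qed
    then have "periodic_sequence (map ?u [0..<?p + ?p]) = ?u"
      by (rule periodic_sequence_of_periodic) simp
    moreover have "map ?u [0..<?p + ?p] = map ?u [0..<?p] @ conj_word (map ?u [0..<?p])"
    proof (rule nth_equalityI)
      fix i assume i: "i < length (map ?u [0..<?p + ?p])"
      have "?u i = conj_symbol (?u (i - ?p))" if "\<not> i < ?p"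
        using conj[of "i - ?p"] that by simp
      then show "map ?u [0..<?p + ?p] ! i = (map ?u [0..<?p] @ conj_word (map ?u [0..<?p])) ! i"
        using i by (auto simp: nth_append simp del: upt_Suc)
    qed (simp del: upt_Suc)
    moreover have "map ?u [0..<?p] = lift_word P @ [B\<^sub>b]"
      using False u_head u_turn by simp
    ultimately have "periodic_sequence ((lift_word P @ [B\<^sub>b]) @ conj_word (lift_word P @ [B\<^sub>b])) = ?u"
      by metis
    then show ?thesis
      using False by (simp add: lift_data_def)
  qed
qed

text \<open>The letter after the base word is \<open>A\<close> or \<open>B\<close> and tells the two types apart.\<close>

lemma kneading_data_eqI:
  assumes "itinerary_c1 S = itinerary_c1 S'" and "length (base_word S) = length (base_word S')"
  shows "S = S'"
proof -
  have nth_base: "itinerary_c1 T i = base_word T ! i" if "i < length (base_word T)" for T i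
    using that by (cases T) (simp_all add: periodic_sequence_def nth_append)
  have turn: "itinerary_c1 T (length (base_word T)) = (case T of Stable_Pair _ \<Rightarrow> A\<^sub>b | _ \<Rightarrow> B\<^sub>b)" for T
    by (cases T) (simp_all add: periodic_sequence_def nth_append)
  have "base_word S = base_word S'"
    using assms nth_base by (metis nth_equalityI)
  moreover have "(case S of Stable_Pair _ \<Rightarrow> A\<^sub>b | _ \<Rightarrow> B\<^sub>b) = (case S' of Stable_Pair _ \<Rightarrow> A\<^sub>b | _ \<Rightarrow> B\<^sub>b)"
    using assms turn by metis
  ultimately show ?thesis
    by (cases S; cases S') auto
qed

section \<open>Comparing the signed orders\<close>

text \<open>The hypothesis says that no \<open>C\<close> occurs before the first difference; a common \<open>C\<close> would count
  for the parity of the time but for neither number of reversals.\<close>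

lemma signed_lex_less_lift_iff:
  assumes no_C: "\<And>n k. \<forall>k<n. s k = t k \<Longrightarrow> s n \<noteq> t n \<Longrightarrow> k < n \<Longrightarrow> s k \<noteq> C\<^sub>u"
  shows "signed_lex_less M\<^sub>b (lift_sequence s) (lift_sequence t) \<longleftrightarrow> signed_lex_less R\<^sub>u s t"
proof -
  have "(if even (card {k. k < n \<and> lift_sequence s k = M\<^sub>b})
         then lift_sequence s n < lift_sequence t n else lift_sequence t n < lift_sequence s n) \<longleftrightarrow>
        (if even (card {k. k < n \<and> s k = R\<^sub>u}) then s n < t n else t n < s n)"
    if eq: "\<forall>k<n. s k = t k" for n
  proof (cases "s n = t n")
    case True
    then show ?thesis
      by (simp add: lift_sequence_def)
  next
    case False
    let ?MM = "{k. k < n \<and> lift_sequence s k = M\<^sub>b}" and ?RR = "{k. k < n \<and> s k = R\<^sub>u}"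
    have M_iff_L: "lift_sequence s k = M\<^sub>b \<longleftrightarrow> s k = L\<^sub>u" for k
      by (cases "s k") (simp_all add: lift_sequence_def)
    have "?MM \<union> ?RR = {..<n}"
    proof (intro equalityI subsetI)
      fix k assume "k \<in> {..<n}"
      then have "s k \<noteq> C\<^sub>u"
        using no_C[OF eq False] by simp
      then show "k \<in> ?MM \<union> ?RR"
        using \<open>k \<in> {..<n}\<close> M_iff_L by (cases "s k") auto
    qed auto
    moreover have "card (?MM \<union> ?RR) = card ?MM + card ?RR"
      by (rule card_Un_disjoint) (auto simp: M_iff_L)
    ultimately have "even (card ?MM) \<longleftrightarrow> (even n \<longleftrightarrow> even (card ?RR))"
      using even_add[of "card ?MM" "card ?RR"] card_lessThan[of n] by argo
    moreover have "lift_symbol n x < lift_symbol n y \<longleftrightarrow> (if even n then x < y else y < x)" for x y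
      by (cases x; cases y) (auto simp: less_bimodal_symbol_def less_unimodal_symbol_def)
    ultimately show ?thesis
      by (simp add: lift_sequence_def)
  qed
  moreover have "(\<forall>k<n. lift_sequence s k = lift_sequence t k) \<longleftrightarrow> (\<forall>k<n. s k = t k)" for n
    by (simp add: lift_sequence_def)
  ultimately show ?thesis
    unfolding signed_lex_less_def by (simp cong: conj_cong)
qed

text \<open>The first \<open>C\<close> of \<open>(P C)\<^sup>\<infinity>\<close> stands at position \<open>length P\<close>, so a common prefix containing a \<open>C\<close>
  determines both words and leaves no room for a later difference.\<close>

lemma no_common_C_before_difference:
  assumes "set P \<subseteq> {L\<^sub>u, R\<^sub>u}" and "set Q \<subseteq> {L\<^sub>u, R\<^sub>u}"
    and eq: "\<forall>k<n. periodic_sequence (P @ [C\<^sub>u]) k = periodic_sequence (Q @ [C\<^sub>u]) k"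
    and ne: "periodic_sequence (P @ [C\<^sub>u]) n \<noteq> periodic_sequence (Q @ [C\<^sub>u]) n"
    and "k < n"
  shows "periodic_sequence (P @ [C\<^sub>u]) k \<noteq> C\<^sub>u"
proof
  assume C: "periodic_sequence (P @ [C\<^sub>u]) k = C\<^sub>u"
  have head: "periodic_sequence (W @ [C\<^sub>u]) i = W ! i" if "i < length W" for W i
    using that by (simp add: periodic_sequence_def nth_append)
  have turn: "periodic_sequence (W @ [C\<^sub>u]) (length W) = C\<^sub>u" for W
    by (simp add: periodic_sequence_def)
  have late: "length W \<le> i" if "periodic_sequence (W @ [C\<^sub>u]) i = C\<^sub>u" "set W \<subseteq> {L\<^sub>u, R\<^sub>u}" for W i
  proof (rule ccontr)
    assume "\<not> length W \<le> i"
    then have "W ! i \<in> {L\<^sub>u, R\<^sub>u}"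
      using that(2) by (metis nth_mem not_le subsetD)
    then show False
      using that(1) head \<open>\<not> length W \<le> i\<close> by auto
  qed
  have P: "length P < n" and Q: "length Q < n"
    using late[OF C] late[of Q k] C assms by auto
  then have "length Q \<le> length P" and "length P \<le> length Q"
    using late[of Q "length P"] late[of P "length Q"] turn[of P] turn[of Q] eq assms(1,2) by simp_all
  then have len: "length P = length Q"
    by simp
  have "P ! i = Q ! i" if "i < length P" for i
    using head[of i P] head[of i Q] eq P len that by simp
  then have "P = Q"
    by (rule nth_equalityI[OF len])
  then show False
    using ne by simp
qed

lemma itinerary_c1_lift_less_iff:
  assumes "set P \<subseteq> {L\<^sub>u, R\<^sub>u}" and "set Q \<subseteq> {L\<^sub>u, R\<^sub>u}"
  shows "signed_lex_less M\<^sub>b (itinerary_c1 (lift_data P)) (itinerary_c1 (lift_data Q)) \<longleftrightarrow>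
    signed_lex_less R\<^sub>u (periodic_sequence (P @ [C\<^sub>u])) (periodic_sequence (Q @ [C\<^sub>u]))"
  unfolding itinerary_c1_lift_data
  by (rule signed_lex_less_lift_iff) (rule no_common_C_before_difference[OF assms])

text \<open>The two bounds are the lifts of \<open>L\<^sup>\<infinity>\<close> and \<open>R L\<^sup>\<infinity>\<close>, which are the least and the greatest sequence
  in the unimodal order; a sequence containing a \<open>C\<close> differs from both.\<close>

lemma lift_sequence_between:
  assumes "t m = C\<^sub>u"
  shows "signed_lex_less M\<^sub>b (\<lambda>_. M\<^sub>b) (lift_sequence t)"
    and "signed_lex_less M\<^sub>b (lift_sequence t) (\<lambda>n. if n = 0 then R\<^sub>b else M\<^sub>b)"
proof -
  have first_difference: "\<exists>n. (\<forall>k<n. t k = u k) \<and> t n \<noteq> u n" if "u m \<noteq> C\<^sub>u" for u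
    using exists_least_iff[of "\<lambda>n. t n \<noteq> u n"] assms that by metis
  let ?l = "\<lambda>_::nat. L\<^sub>u" and ?r = "\<lambda>n::nat. if n = 0 then R\<^sub>u else L\<^sub>u"
  obtain n where n: "\<forall>k<n. t k = L\<^sub>u" "t n \<noteq> L\<^sub>u"
    using first_difference[of ?l] by auto
  have "signed_lex_less R\<^sub>u ?l t"
    unfolding signed_lex_less_def
    by (rule exI[of _ n]) (use n in \<open>cases "t n"; auto simp: less_unimodal_symbol_def\<close>)
  moreover have "lift_sequence ?l = (\<lambda>_. M\<^sub>b)"
    by (simp add: lift_sequence_def fun_eq_iff)
  ultimately show "signed_lex_less M\<^sub>b (\<lambda>_. M\<^sub>b) (lift_sequence t)"
    using signed_lex_less_lift_iff[of ?l t] by simp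
  have "?r m \<noteq> C\<^sub>u"
    by simp
  then obtain n where n: "\<forall>k<n. t k = ?r k" "t n \<noteq> ?r n"
    using first_difference[of ?r] by blast
  have "signed_lex_less R\<^sub>u t ?r"
  proof (cases "n = 0")
    case True
    then show ?thesis
      unfolding signed_lex_less_def
      by (intro exI[of _ n]) (use n in \<open>cases "t n"; auto simp: less_unimodal_symbol_def\<close>)
  next
    case False
    then have "{k. k < n \<and> t k = R\<^sub>u} = {0}"
      using n(1) by (auto split: if_splits)
    then show ?thesis
      unfolding signed_lex_less_def
      by (intro exI[of _ n]) (use n False in \<open>cases "t n"; auto simp: less_unimodal_symbol_def\<close>)
  qed
  moreover have "lift_sequence ?r = (\<lambda>n. if n = 0 then R\<^sub>b else M\<^sub>b)"
    by (simp add: lift_sequence_def fun_eq_iff)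
  moreover have "t k \<noteq> C\<^sub>u" if "\<forall>k<n. t k = ?r k" "k < n" for n k
    using that by simp
  ultimately show "signed_lex_less M\<^sub>b (lift_sequence t) (\<lambda>n. if n = 0 then R\<^sub>b else M\<^sub>b)"
    using signed_lex_less_lift_iff[of t ?r] by simp
qed

section \<open>Folding an odd map\<close>

lemma bimodal_symbol_of_alternating:
  assumes "0 < y" and "0 < c"
  shows "bimodal_symbol_of (- c) c ((- 1) ^ n * y) = lift_symbol n (unimodal_symbol_of c y)"
  using assms by (cases "even n") (auto simp: bimodal_symbol_of_def unimodal_symbol_of_def)

lemma bimodal_symbol_of_minus:
  assumes "0 < c"
  shows "bimodal_symbol_of (- c) c (- x) = conj_symbol (bimodal_symbol_of (- c) c x)"
  using assms by (auto simp: bimodal_symbol_of_def)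

text \<open>Since \<open>f\<close> is odd, \<open>f ((-1)\<^sup>n y) = (-1)\<^sup>n\<^sup>+\<^sup>1 g y\<close>; positivity of \<open>g\<close> keeps the orbit away from \<open>0\<close>, so
  the sign of the \<open>n\<close>-th iterate is exactly \<open>(-1)\<^sup>n\<close>.\<close>

lemma bimodal_itinerary_eq_lift:
  assumes "0 < c" and "x \<in> {0<..b}"
    and odd: "\<And>y. y \<in> {0<..b} \<Longrightarrow> f (- y) = - f y"
    and g: "\<And>y. y \<in> {0<..b} \<Longrightarrow> g y = - f y"
    and into: "\<And>y. y \<in> {0<..b} \<Longrightarrow> g y \<in> {0<..b}"
  shows "bimodal_itinerary f (- c) c x = lift_sequence (unimodal_itinerary g c x)"
proof -
  have iter: "(g ^^ n) x \<in> {0<..b} \<and> (f ^^ n) x = (- 1) ^ n * (g ^^ n) x" for n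
  proof (induction n)
    case (Suc n)
    then show ?case
      using into[of "(g ^^ n) x"] g[of "(g ^^ n) x"] odd[of "(g ^^ n) x"]
      by (cases "even n") auto
  qed (use assms in simp)
  show ?thesis
    unfolding bimodal_itinerary_def unimodal_itinerary_def lift_sequence_def fun_eq_iff
    using iter bimodal_symbol_of_alternating[OF _ \<open>0 < c\<close>] by simp
qed

lemma bimodal_itinerary_minus:
  assumes "symmetric_bimodal f c0 c1 c2 c3" and "x \<in> {c0..c3}"
  shows "bimodal_itinerary f c1 c2 (- x) = conj_symbol \<circ> bimodal_itinerary f c1 c2 x"
proof -
  have into: "f ` {c0..c3} \<subseteq> {c0..c3}" and odd: "\<forall>x\<in>{c0..c3}. f (- x) = - f x"
    and c: "c1 = - c2" "0 < c2"
    using assms(1) by (auto simp: symmetric_bimodal_def)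
  have iter: "(f ^^ n) x \<in> {c0..c3} \<and> (f ^^ n) (- x) = - (f ^^ n) x" for n
  proof (induction n)
    case (Suc n)
    then show ?case
      using into odd image_subset_iff[of f "{c0..c3}" "{c0..c3}"] by simp
  qed (use assms in simp)
  show ?thesis
    unfolding bimodal_itinerary_def fun_eq_iff comp_def c
    using iter bimodal_symbol_of_minus[OF \<open>0 < c2\<close>] by simp
qed

text \<open>On the lap \<open>M\<close> the map changes the sign. So the itinerary of a point \<open>y \<ge> 0\<close>, as long as it
  reads \<open>M\<close>, alternates between the two sides of \<open>0\<close>, and it leaves \<open>M\<close> on the side that makes it
  larger than \<open>M\<^sup>\<infinity>\<close>.\<close>

lemma negative_if_itinerary_less_M:
  assumes f: "symmetric_bimodal f c0 c1 c2 c3" and "y \<in> {c0..c3}"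
    and less: "signed_lex_less M\<^sub>b (bimodal_itinerary f c1 c2 y) (\<lambda>_. M\<^sub>b)"
  shows "y < 0"
proof (rule ccontr)
  assume "\<not> y < 0"
  have c: "c1 < 0" "0 < c2" "c2 < c3" "c0 = - c3"
    and odd: "\<forall>x\<in>{c0..c3}. f (- x) = - f x"
    and anti: "strict_antimono_on {c1..c2} f"
    using f by (auto simp: symmetric_bimodal_def)
  have "f 0 = 0"
    using bspec[OF odd, of 0] c by simp
  have flip: "(x \<ge> 0 \<longrightarrow> f x \<le> 0) \<and> (x \<le> 0 \<longrightarrow> f x \<ge> 0)" if "c1 < x" "x < c2" for x
    using monotone_onD[OF anti, of 0 x] monotone_onD[OF anti, of x 0] that c \<open>f 0 = 0\<close>
    by (cases x "0::real" rule: linorder_cases) auto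
  obtain n where M: "\<forall>k<n. bimodal_itinerary f c1 c2 y k = M\<^sub>b"
    and n: "if even (card {k. k < n \<and> bimodal_itinerary f c1 c2 y k = M\<^sub>b})
      then bimodal_itinerary f c1 c2 y n < M\<^sub>b else M\<^sub>b < bimodal_itinerary f c1 c2 y n"
    using less unfolding signed_lex_less_def by auto
  have "{k. k < n \<and> bimodal_itinerary f c1 c2 y k = M\<^sub>b} = {..<n}"
    using M by auto
  then have n': "if even n then bimodal_itinerary f c1 c2 y n < M\<^sub>b else M\<^sub>b < bimodal_itinerary f c1 c2 y n"
    using n by simp
  have sign: "if even k then (f ^^ k) y \<ge> 0 else (f ^^ k) y \<le> 0" if "k \<le> n" for k
    using that
  proof (induction k)
    case 0
    then show ?case
      using \<open>\<not> y < 0\<close> by simp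
  next
    case (Suc k)
    have "bimodal_symbol_of c1 c2 ((f ^^ k) y) = M\<^sub>b"
      using M Suc.prems by (simp add: bimodal_itinerary_def)
    then have "c1 < (f ^^ k) y" "(f ^^ k) y < c2"
      by (auto simp: bimodal_symbol_of_def split: if_splits)
    then show ?case
      using flip[of "(f ^^ k) y"] Suc by (cases "even k") auto
  qed
  show False
    using n' sign[of n] c
    by (auto simp: bimodal_itinerary_def bimodal_symbol_of_def less_bimodal_symbol_def
        split: if_splits)
qed

text \<open>The interval of the folded map has to contain the largest value \<open>f c1\<close>, to reach beyond the
  turning point \<open>c2\<close>, and to stop before \<open>f\<close> becomes positive. If \<open>f c1 > c2\<close> it ends at \<open>f c1\<close>;
  otherwise continuity at \<open>c2\<close> leaves some room.\<close>

lemma folded_unimodal_map: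
  assumes f: "symmetric_bimodal f c0 c1 c2 c3"
    and less: "signed_lex_less M\<^sub>b (bimodal_itinerary f c1 c2 (f c1)) (\<lambda>n. if n = 0 then R\<^sub>b else M\<^sub>b)"
  obtains g b where "unimodal g 0 c2 b"
    and "bimodal_itinerary f c1 c2 (f c1) = lift_sequence (unimodal_itinerary g c2 (g c2))"
proof -
  have c: "c1 = - c2" "0 < c2" "c2 < c3" "c0 = - c3"
    and odd: "\<forall>x\<in>{c0..c3}. f (- x) = - f x"
    and cont: "continuous_on {c0..c3} f" and into: "f ` {c0..c3} \<subseteq> {c0..c3}"
    and anti: "strict_antimono_on {c1..c2} f" and mono: "strict_mono_on {c2..c3} f"
    using f by (auto simp: symmetric_bimodal_def)
  have "f 0 = 0"
    using bspec[OF odd, of 0] c by simp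
  define v where "v = f c1"
  have "f c1 \<in> {c0..c3}"
    by (rule subsetD[OF into imageI]) (use c in simp)
  then have v: "0 < v" "f c2 = - v" "v \<in> {c0..c3}"
    using monotone_onD[OF anti, of c1 0] odd c \<open>f 0 = 0\<close> by (auto simp: v_def)
  obtain b where b: "c2 < b" "b \<le> c3" "v \<le> b" "f b < 0"
  proof (cases "c2 < v")
    case True
    have shift: "bimodal_itinerary f c1 c2 v (Suc n) = bimodal_itinerary f c1 c2 (f v) n" for n
      by (simp add: bimodal_itinerary_def funpow_swap1)
    have start: "bimodal_itinerary f c1 c2 v 0 = R\<^sub>b"
      using True c by (simp add: bimodal_itinerary_def bimodal_symbol_of_def)
    obtain n where n: "\<forall>k<n. bimodal_itinerary f c1 c2 v k = (if k = 0 then R\<^sub>b else M\<^sub>b)"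
      "if even (card {k. k < n \<and> bimodal_itinerary f c1 c2 v k = M\<^sub>b})
       then bimodal_itinerary f c1 c2 v n < (if n = 0 then R\<^sub>b else M\<^sub>b)
       else (if n = 0 then R\<^sub>b else M\<^sub>b) < bimodal_itinerary f c1 c2 v n"
      using less unfolding signed_lex_less_def v_def by blast
    have "n \<noteq> 0"
      using n(2) start by (auto split: if_splits)
    then obtain m where m: "n = Suc m"
      using not0_implies_Suc by blast
    have "{k. k < n \<and> bimodal_itinerary f c1 c2 v k = M\<^sub>b} =
        Suc ` {k. k < m \<and> bimodal_itinerary f c1 c2 (f v) k = M\<^sub>b}"
    proof (intro equalityI subsetI)
      fix k assume k: "k \<in> {k. k < n \<and> bimodal_itinerary f c1 c2 v k = M\<^sub>b}"
      then obtain j where "k = Suc j"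
        using start by (cases k) auto
      then show "k \<in> Suc ` {k. k < m \<and> bimodal_itinerary f c1 c2 (f v) k = M\<^sub>b}"
        using k m shift by auto
    qed (use m shift in auto)
    then have "signed_lex_less M\<^sub>b (bimodal_itinerary f c1 c2 (f v)) (\<lambda>_. M\<^sub>b)"
      unfolding signed_lex_less_def using n m shift
      by (intro exI[of _ m]) (force simp: card_image)
    then have "f v < 0"
      using negative_if_itinerary_less_M[OF f, of "f v"] v(3) into by blast
    then show thesis
      using True v(3) by (intro that[of v]) auto
  next
    case False
    \<comment> \<open>Here \<open>f c1 \<le> c2\<close>, so every point slightly to the right of \<open>c2\<close> is large enough.\<close>
    have "(f \<longlongrightarrow> f c2) (at c2 within {c0..c3})"
      using cont c by (simp add: continuous_on_def)
    then have "eventually (\<lambda>x. f x < 0) (at c2 within {c0..c3})"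
      using v by (intro order_tendstoD) auto
    then obtain d where d: "d > 0" "\<And>x. x \<in> {c0..c3} \<Longrightarrow> x \<noteq> c2 \<Longrightarrow> dist x c2 < d \<Longrightarrow> f x < 0"
      by (auto simp: eventually_at)
    let ?b = "min c3 (c2 + d / 2)"
    have "f ?b < 0"
      using d(1) c by (intro d(2)) (auto simp: dist_real_def)
    then show thesis
      using d(1) c False by (intro that[of ?b]) auto
  qed
  define g where "g = (\<lambda>x. - f x)"
  have g_bounds: "g y \<in> {0<..b}" if "y \<in> {0<..b}" for y
  proof (cases "y \<le> c2")
    case True
    then have "f y < f 0" "f c2 \<le> f y"
      using monotone_onD[OF anti, of 0 y] monotone_onD[OF anti, of y c2] that c
      by (cases "y = c2"; force)+
    then show ?thesis
      using \<open>f 0 = 0\<close> v b by (simp add: g_def)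
  next
    case False
    then have "f y \<le> f b" "f c2 < f y"
      using monotone_onD[OF mono, of y b] monotone_onD[OF mono, of c2 y] that c b
      by (cases "y = b"; force)+
    then show ?thesis
      using v b by (simp add: g_def)
  qed
  have "unimodal g 0 c2 b"
    unfolding unimodal_def
  proof (intro conjI)
    show "continuous_on {0..b} g"
      unfolding g_def using b c by (intro continuous_on_minus continuous_on_subset[OF cont]) auto
    show "g ` {0..b} \<subseteq> {0..b}"
    proof (intro image_subsetI)
      fix y assume "y \<in> {0..b}"
      then show "g y \<in> {0..b}"
        using g_bounds[of y] \<open>f 0 = 0\<close> by (cases "y = 0") (auto simp: g_def)
    qed
    show "strict_mono_on {0..c2} g"
      using c monotone_onD[OF anti] by (auto intro!: monotone_onI simp: g_def)
    show "strict_antimono_on {c2..b} g"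
      using b monotone_onD[OF mono] by (auto intro!: monotone_onI simp: g_def)
  qed (use b c in auto)
  moreover have "bimodal_itinerary f (- c2) c2 v = lift_sequence (unimodal_itinerary g c2 v)"
    by (rule bimodal_itinerary_eq_lift[where b = b]) (use b c v odd g_bounds in \<open>auto simp: g_def\<close>)
  ultimately show thesis
    using that v(2) c by (simp add: g_def v_def)
qed

section \<open>Unfolding a unimodal map\<close>

text \<open>The map is extended linearly over an interval of length \<open>1\<close> to the left of \<open>a\<close>, and the new left
  end point \<open>a - 1\<close>, which becomes a fixed point, is translated to \<open>0\<close>.\<close>

lemma unimodal_fixing_left_endpoint:
  assumes "unimodal g a c b"
  obtains h c' b' where "unimodal h 0 c' b'" and "h 0 = 0" and "\<And>x. x \<in> {0<..b'} \<Longrightarrow> 0 < h x"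
    and "unimodal_itinerary h c' (h c') = unimodal_itinerary g c (g c)"
proof -
  have ac: "a < c" "c < b" and cont: "continuous_on {a..b} g" and into: "g ` {a..b} \<subseteq> {a..b}"
    and mono: "strict_mono_on {a..c} g" and anti: "strict_antimono_on {c..b} g"
    using assms by (auto simp: unimodal_def)
  define z where "z = a - 1"
  have into': "g y \<in> {a..b}" if "y \<in> {a..b}" for y
    using that into by blast
  \<comment> \<open>The slope \<open>m\<close> makes the two pieces agree at \<open>1\<close>, which corresponds to \<open>a\<close>.\<close>
  define m where "m = g a - z"
  define h where "h x = (if x \<le> 1 then m * x else g (x + z) - z)" for x
  have m: "m \<ge> 1"
    using into'[of a] ac by (simp add: m_def z_def)
  have h_right: "h x = g (x + z) - z" if "x \<ge> 1" for x
    using that by (auto simp: h_def m_def z_def)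
  have h_left: "h x = m * x" if "x \<le> 1" for x
    using that by (simp add: h_def)
  have h_right_bounds: "h x \<in> {1..b - z}" if "x \<in> {1..b - z}" for x
    using that into'[of "x + z"] by (auto simp: h_right z_def)
  have "continuous_on ({0..1} \<union> {1..b - z}) h"
  proof (rule continuous_on_closed_Un)
    have "continuous_on {0..1} (\<lambda>x. m * x)"
      by (intro continuous_intros)
    then show "continuous_on {0..1} h"
      by (rule continuous_on_cong[THEN iffD1, rotated 2]) (simp_all add: h_left)
    have "continuous_on {1..b - z} (\<lambda>x. g (x + z) - z)"
      by (intro continuous_intros continuous_on_compose2[OF cont]) (auto simp: z_def)
    then show "continuous_on {1..b - z} h"
      by (rule continuous_on_cong[THEN iffD1, rotated 2]) (simp_all add: h_right)
  qed auto
  moreover have "{0..1} \<union> {1..b - z} = {0..b - z}"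
    using ac by (auto simp: z_def)
  ultimately have h_cont: "continuous_on {0..b - z} h"
    by simp
  have h_mono_left: "h x < h y" if "x < y" "y \<le> 1" for x y
    using that m by (simp add: h_left)
  have h_mono_right: "h x < h y" if "1 \<le> x" "x < y" "y \<le> c - z" for x y
    using that monotone_onD[OF mono, of "x + z" "y + z"] by (simp add: h_right z_def)
  have "unimodal h 0 (c - z) (b - z)"
    unfolding unimodal_def
  proof (intro conjI)
    show "h ` {0..b - z} \<subseteq> {0..b - z}"
    proof (intro image_subsetI)
      fix x assume x: "x \<in> {0..b - z}"
      show "h x \<in> {0..b - z}"
      proof (cases "x \<le> 1")
        case True
        then have "m * x \<le> m * 1"
          using m by (intro mult_left_mono) auto
        moreover have "m \<le> b - z"
          using into'[of a] ac by (simp add: m_def)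
        ultimately have "m * x \<le> b - z"
          by linarith
        then show ?thesis
          using True x m h_left[of x] by simp
      next
        case False
        then show ?thesis
          using x h_right_bounds[of x] by auto
      qed
    qed
    show "strict_mono_on {0..c - z} h"
    proof (rule monotone_onI)
      fix x y assume "x \<in> {0..c - z}" "y \<in> {0..c - z}" "x < y"
      then show "h x < h y"
        using h_mono_left[of x y] h_mono_right[of x y] h_mono_left[of x 1] h_mono_right[of 1 y]
        by (cases "x < 1"; cases "1 < y") auto
    qed
    show "strict_antimono_on {c - z..b - z} h"
    proof (rule monotone_onI)
      fix x y assume "x \<in> {c - z..b - z}" "y \<in> {c - z..b - z}" "x < y"
      then show "h y < h x"
        using monotone_onD[OF anti, of "x + z" "y + z"] ac by (auto simp: h_right z_def)
    qed
  qed (use ac h_cont in \<open>auto simp: z_def\<close>)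
  moreover have "h 0 = 0"
    by (simp add: h_left)
  moreover have "0 < h x" if "x \<in> {0<..b - z}" for x
    using that m h_right_bounds[of x] by (cases "x \<le> 1") (auto simp: h_left)
  moreover have "unimodal_itinerary h (c - z) (h (c - z)) = unimodal_itinerary g c (g c)"
  proof -
    have hc: "h (c - z) = g c - z"
      using ac by (simp add: h_right z_def)
    have "(g ^^ n) (g c) \<in> {a..b} \<and> (h ^^ n) (h (c - z)) = (g ^^ n) (g c) - z" for n
    proof (induction n)
      case 0
      then show ?case
        using into'[of c] ac hc by simp
    next
      case (Suc n)
      then show ?case
        using into'[of "(g ^^ n) (g c)"] h_right[of "(g ^^ n) (g c) - z"] by (simp add: z_def)
    qed
    then show ?thesis
      by (simp add: unimodal_itinerary_def unimodal_symbol_of_def fun_eq_iff)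
  qed
  ultimately show thesis
    using that by blast
qed

lemma odd_extension_realizes:
  assumes h: "unimodal h 0 c b" and "h 0 = 0" and pos: "\<And>x. x \<in> {0<..b} \<Longrightarrow> 0 < h x"
  obtains f where "symmetric_bimodal f (- b) (- c) c b"
    and "bimodal_itinerary f (- c) c (f (- c)) = lift_sequence (unimodal_itinerary h c (h c))"
proof -
  have c: "0 < c" "c < b" and cont: "continuous_on {0..b} h" and into: "h ` {0..b} \<subseteq> {0..b}"
    and mono: "strict_mono_on {0..c} h" and anti: "strict_antimono_on {c..b} h"
    using h by (auto simp: unimodal_def)
  define f where "f x = (if x \<le> 0 then h (- x) else - h x)" for x
  have f_pos: "f x = - h x" if "x \<ge> 0" for x
    using that \<open>h 0 = 0\<close> by (auto simp: f_def)
  have f_neg: "f x = h (- x)" if "x \<le> 0" for x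
    using that by (simp add: f_def)
  have f_odd: "f (- x) = - f x" for x
    by (cases "x \<ge> 0") (simp_all add: f_pos f_neg)
  have into': "h x \<in> {0..b}" if "x \<in> {0..b}" for x
    using that into by blast
  have "continuous_on ({- b..0} \<union> {0..b}) f"
  proof (rule continuous_on_closed_Un)
    have "continuous_on {- b..0} (\<lambda>x. h (- x))"
      by (intro continuous_on_compose2[OF cont] continuous_intros) auto
    then show "continuous_on {- b..0} f"
      by (rule continuous_on_cong[THEN iffD1, rotated 2]) (simp_all add: f_neg)
    have "continuous_on {0..b} (\<lambda>x. - h x)"
      by (intro continuous_intros cont)
    then show "continuous_on {0..b} f"
      by (rule continuous_on_cong[THEN iffD1, rotated 2]) (simp_all add: f_pos)
  qed auto
  moreover have "{- b..0} \<union> {0..b} = {- b..b}"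
    using c by auto
  ultimately have f_cont: "continuous_on {- b..b} f"
    by simp
  have "symmetric_bimodal f (- b) (- c) c b"
    unfolding symmetric_bimodal_def
  proof (intro conjI)
    show "f ` {- b..b} \<subseteq> {- b..b}"
    proof (intro image_subsetI)
      fix x assume "x \<in> {- b..b}"
      then show "f x \<in> {- b..b}"
        using into'[of x] into'[of "- x"] by (cases "x \<ge> 0") (auto simp: f_pos f_neg)
    qed
    show "strict_mono_on {- b..- c} f"
      using monotone_onD[OF anti] c by (auto intro!: monotone_onI simp: f_neg)
    show "strict_mono_on {c..b} f"
      using monotone_onD[OF anti] c by (auto intro!: monotone_onI simp: f_pos)
    have neg: "f y < f x" if "- c \<le> x" "x < y" "y \<le> 0" for x y
      using that monotone_onD[OF mono, of "- y" "- x"] by (simp add: f_neg)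
    have pos: "f y < f x" if "0 \<le> x" "x < y" "y \<le> c" for x y
      using that monotone_onD[OF mono, of x y] by (simp add: f_pos)
    show "strict_antimono_on {- c..c} f"
    proof (rule monotone_onI)
      fix x y assume "x \<in> {- c..c}" "y \<in> {- c..c}" "x < y"
      then show "f y < f x"
        using neg[of x y] pos[of x y] neg[of x 0] pos[of 0 y]
        by (cases "x < 0"; cases "0 < y") auto
    qed
  qed (use c f_odd f_cont in auto)
  moreover have "bimodal_itinerary f (- c) c (h c) = lift_sequence (unimodal_itinerary h c (h c))"
  proof (rule bimodal_itinerary_eq_lift[where b = b])
    show "h y \<in> {0<..b}" if "y \<in> {0<..b}" for y
      using that pos[of y] into'[of y] by simp
    then show "h c \<in> {0<..b}"
      using c by simp
  qed (use c f_odd f_pos in auto)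
  moreover have "f (- c) = h c"
    using c by (simp add: f_neg)
  ultimately show thesis
    using that by simp
qed

section \<open>The isomorphism\<close>

text \<open>Folding determines the type as well as the word: the itinerary of an element of \<open>\<D>\<^sub>1\<close> is a
  lift, so the turning point met after the base word is dictated by the parity of its length.\<close>

lemma \<D>\<^sub>1_eq_lift: "\<D>\<^sub>1 = lift_data ` {P. P @ [C\<^sub>u] \<in> \<T>_KS}"
proof (intro equalityI subsetI)
  fix S assume S: "S \<in> \<D>\<^sub>1"
  let ?P = "map fold_symbol (base_word S)"
  obtain f c0 c1 c2 c3 where f: "symmetric_bimodal f c0 c1 c2 c3" and "realizes f c1 c2 S"
    and set: "set (base_word S) \<subseteq> {L\<^sub>b, M\<^sub>b, R\<^sub>b}"
    using S by (auto simp: \<D>\<^sub>1_def \<D>_def)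
  then have itin: "bimodal_itinerary f c1 c2 (f c1) = itinerary_c1 S"
    by (cases S) auto
  then have "signed_lex_less M\<^sub>b (bimodal_itinerary f c1 c2 (f c1)) (\<lambda>n. if n = 0 then R\<^sub>b else M\<^sub>b)"
    using S by (simp add: \<D>\<^sub>1_def)
  then obtain g b where g: "unimodal g 0 c2 b"
    and lift: "itinerary_c1 S = lift_sequence (unimodal_itinerary g c2 (g c2))"
    using folded_unimodal_map[OF f] itin by metis
  have "fold_symbol \<circ> itinerary_c1 S = unimodal_itinerary g c2 (g c2)"
    unfolding lift by (simp add: fun_eq_iff lift_sequence_def)
  then have word: "unimodal_itinerary g c2 (g c2) = periodic_sequence (?P @ [C\<^sub>u])"
    by (simp add: fold_itinerary_c1)
  have "set ?P \<subseteq> {L\<^sub>u, R\<^sub>u}"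
    using set by auto
  then have "?P @ [C\<^sub>u] \<in> \<T>_KS"
    using g word by (auto simp: \<T>_KS_def)
  moreover have "S = lift_data ?P"
    using lift word by (intro kneading_data_eqI) (simp_all add: itinerary_c1_lift_data)
  ultimately show "S \<in> lift_data ` {P. P @ [C\<^sub>u] \<in> \<T>_KS}"
    by blast
next
  fix S assume "S \<in> lift_data ` {P. P @ [C\<^sub>u] \<in> \<T>_KS}"
  then obtain P g a c b where S: "S = lift_data P" and set: "set P \<subseteq> {L\<^sub>u, R\<^sub>u}"
    and g: "unimodal g a c b" and word: "unimodal_itinerary g c (g c) = periodic_sequence (P @ [C\<^sub>u])"
    by (auto simp: \<T>_KS_def)
  obtain h c' b' where h: "unimodal h 0 c' b'" "h 0 = 0" "\<And>x. x \<in> {0<..b'} \<Longrightarrow> 0 < h x"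
    and h_itin: "unimodal_itinerary h c' (h c') = periodic_sequence (P @ [C\<^sub>u])"
    using unimodal_fixing_left_endpoint[OF g] word by metis
  obtain f where f: "symmetric_bimodal f (- b') (- c') c' b'"
    and itin: "bimodal_itinerary f (- c') c' (f (- c')) = itinerary_c1 S"
    using odd_extension_realizes[OF h] h_itin S itinerary_c1_lift_data by metis
  have "realizes f (- c') c' S"
  proof (cases S)
    case (Stable_Pair W)
    have "- c' \<in> {- b'..b'}" and "c' \<in> {- b'..b'}"
      using f by (auto simp: symmetric_bimodal_def)
    then have "f c' = - f (- c')" and "f (- c') \<in> {- b'..b'}"
      using f unfolding symmetric_bimodal_def by (force, blast)
    then have "bimodal_itinerary f (- c') c' (f c') = conj_symbol \<circ> periodic_sequence (W @ [A\<^sub>b])"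
      using bimodal_itinerary_minus[OF f] itin Stable_Pair by simp
    also have "\<dots> = periodic_sequence (conj_word W @ [B\<^sub>b])"
      using periodic_sequence_map[of "W @ [A\<^sub>b]" conj_symbol] by simp
    finally show ?thesis
      using itin Stable_Pair by simp
  next
    case (Doubly_Stable W)
    then show ?thesis
      using itin by simp
  qed
  moreover have "set (base_word S) \<subseteq> {L\<^sub>b, M\<^sub>b, R\<^sub>b}"
    using set_lift_word[OF set] S by simp
  ultimately have "S \<in> \<D>"
    using f unfolding \<D>_def by blast
  moreover have "periodic_sequence (P @ [C\<^sub>u]) (length P) = C\<^sub>u"
    by (simp add: periodic_sequence_def)
  then have "signed_lex_less M\<^sub>b (\<lambda>_. M\<^sub>b) (itinerary_c1 S)"
    and "signed_lex_less M\<^sub>b (itinerary_c1 S) (\<lambda>n. if n = 0 then R\<^sub>b else M\<^sub>b)"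
    unfolding S itinerary_c1_lift_data by (rule lift_sequence_between)+
  ultimately show "S \<in> \<D>\<^sub>1"
    by (simp add: \<D>\<^sub>1_def)
qed

theorem theorem1:
  shows "isomorphic_ordered_trees \<D>\<^sub>1_tree \<T>_KS_tree"
proof -
  let ?W = "{P. P @ [C\<^sub>u] \<in> \<T>_KS}"
  define \<phi> where "\<phi> S = map fold_symbol (base_word S) @ [C\<^sub>u]" for S
  have \<phi>_lift: "\<phi> (lift_data P) = P @ [C\<^sub>u]" for P
    by (simp add: \<phi>_def)
  have set: "set P \<subseteq> {L\<^sub>u, R\<^sub>u}" if "P \<in> ?W" for P
    using that by (auto simp: \<T>_KS_def)
  have "w \<in> (\<lambda>P. P @ [C\<^sub>u]) ` ?W" if w: "w \<in> \<T>_KS" for w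
  proof -
    obtain P where "w = P @ [C\<^sub>u]"
      using w unfolding \<T>_KS_def by blast
    then show ?thesis
      using w by blast
  qed
  then have "\<T>_KS = (\<lambda>P. P @ [C\<^sub>u]) ` ?W"
    by blast
  then have image: "\<phi> ` \<D>\<^sub>1 = \<T>_KS"
    unfolding \<D>\<^sub>1_eq_lift image_image \<phi>_lift by simp
  have "inj_on \<phi> \<D>\<^sub>1"
    unfolding \<D>\<^sub>1_eq_lift by (auto simp: inj_on_def \<phi>_lift)
  then have "bij_betw \<phi> \<D>\<^sub>1 \<T>_KS"
    using image by (simp add: bij_betw_def)
  moreover have "prefix (butlast (\<phi> S)) (butlast (\<phi> S')) \<longleftrightarrow> prefix (base_word S) (base_word S')"
    if "S \<in> \<D>\<^sub>1" "S' \<in> \<D>\<^sub>1" for S S'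
    using that unfolding \<D>\<^sub>1_eq_lift by (auto simp: \<phi>_lift prefix_lift_word_iff)
  moreover have "signed_lex_less R\<^sub>u (periodic_sequence (\<phi> S)) (periodic_sequence (\<phi> S')) \<longleftrightarrow>
      signed_lex_less M\<^sub>b (itinerary_c1 S) (itinerary_c1 S')"
    if "S \<in> \<D>\<^sub>1" "S' \<in> \<D>\<^sub>1" for S S'
    using that set unfolding \<D>\<^sub>1_eq_lift by (auto simp: \<phi>_lift itinerary_c1_lift_less_iff)
  moreover have "length (\<phi> S) = Suc (length (base_word S))" for S
    by (simp add: \<phi>_def)
  ultimately show ?thesis
    unfolding isomorphic_ordered_trees_def \<D>\<^sub>1_tree_def \<T>_KS_tree_def
    by (intro exI[of _ \<phi>]) simp
qed

end
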